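(* Let $s\ge 3$. There exists an uncountable set of $s$-tuples $\alpha=(\alpha_1,\dots,\alpha_s)\in\mathbb{R}^s$, with $1,\alpha_1,\dots,\alpha_s$ linearly independent over $\mathbb{Z}$, such that $\operatorname{rk} M_\nu[\alpha]\le 3$ for every $\nu\in\mathbb{N}$; in particular $\det M_\nu[\alpha]=0$ for all $\nu$.
   Context: For $\alpha\in\mathbb{R}^s$, a best simultaneous approximation (b.s.a.) is an integer point $\zeta=(p,a_1,\dots,a_s)\in\mathbb{Z}^{s+1}$ such that $D(\zeta):=\max_{j}|p\alpha_j-a_j|<\min^*\max_j|q\alpha_j-b_j|$, where $\min^*$ is over all $1\le q\le p$ and $(b_1,\dots,b_s)\in\mathbb{Z}^s\setminus\{(a_1,\dots,a_s)\}$. When all $\alpha_j\notin\mathbb{Q}$, the b.s.a. form an infinite sequence $\zeta^\nu=(p^\nu,a_1^\nu,\dots,a_s^\nu)$ with $p^1<p^2<\dots$ and $D(\zeta^1)>D(\zeta^2)>\dots$. $M_\nu[\alpha]$ denotes the $(s+1)\times(s+1)$ matrix whose rows are $\zeta^\nu,\zeta^{\nu+1},\dots,\zeta^{\nu+s}$. *)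

theory Defs
  imports Complex_Main "HOL-Library.Countable_Set"
    "Jordan_Normal_Form.DL_Rank" "Jordan_Normal_Form.Determinant"
begin

text \<open>alpha is an s-tuple of reals, represented as a real list of length s
  (entry j is alpha_(j+1)); an integer point zeta = (p, a_1, ..., a_s) is
  represented as a pair of an integer p and an integer list a of length s.\<close>

definition Dist :: "real list \<Rightarrow> int \<Rightarrow> int list \<Rightarrow> real" where
  "Dist \<alpha> p a = Max ((\<lambda>j. \<bar>of_int p * \<alpha> ! j - of_int (a ! j)\<bar>) ` {..<length \<alpha>})"

definition bsa :: "real list \<Rightarrow> int \<Rightarrow> int list \<Rightarrow> bool" where
  "bsa \<alpha> p a \<longleftrightarrow> p \<ge> 1 \<and> length a = length \<alpha> \<and>
     (\<forall>q b. 1 \<le> q \<and> q \<le> p \<and> length b = length \<alpha> \<and> b \<noteq> a \<longrightarrow>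
        Dist \<alpha> p a < Dist \<alpha> q b)"

definition bsa_p :: "real list \<Rightarrow> nat \<Rightarrow> int" where
  "bsa_p \<alpha> \<nu> = int (enumerate {p. \<exists>a. bsa \<alpha> (int p) a} (\<nu> - 1))"

definition bsa_a :: "real list \<Rightarrow> nat \<Rightarrow> int list" where
  "bsa_a \<alpha> \<nu> = (THE a. bsa \<alpha> (bsa_p \<alpha> \<nu>) a)"

definition M_mat :: "real list \<Rightarrow> nat \<Rightarrow> real mat" where
  "M_mat \<alpha> \<nu> = mat (length \<alpha> + 1) (length \<alpha> + 1)
     (\<lambda>(i, j). if j = 0 then real_of_int (bsa_p \<alpha> (\<nu> + i))
               else real_of_int (bsa_a \<alpha> (\<nu> + i) ! (j - 1)))"

definition Z_lin_indep :: "real list \<Rightarrow> bool" where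
  "Z_lin_indep \<alpha> \<longleftrightarrow> (\<forall>(c0::int) (c::nat \<Rightarrow> int).
     of_int c0 + (\<Sum>j<length \<alpha>. of_int (c j) * \<alpha> ! j) = 0 \<longrightarrow>
     c0 = 0 \<and> (\<forall>j<length \<alpha>. c j = 0))"

end

theory Submission
  imports "HOL-Analysis.Kronecker_Approximation_Theorem" Defs
begin

text \<open>The tuple is a limit of points x(0), x(1), ..., where x(n) is irrational in coordinate n mod s
  only. Passing from x(n) to x(n+1), coordinate n mod s is moved slightly to a rational value and
  coordinate n+1 mod s slightly to an irrational one, so both points lie in the plane E(n) through x(n)
  spanned by these two coordinate directions. Integer points outside the 3-dimensional rational subspace
  over E(n) stay at a fixed distance from x(n) and x(n+1) in one of the unchanged rational coordinates, so
  sufficiently good approximations of a point close to x(n+1) lie in that subspace, up to a bound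
  on p that grows with the closeness. Each x(n) has infinitely many best approximations, and being a best
  approximation with a margin is an open condition; hence the ranges of p governed by E(n)
  and by E(n+1) can be made to overlap in at least s best approximations. Any s+1 consecutive ones then
  lie in a single 3-dimensional subspace. Since in each step only countably many
  irrational values are bad, the limit can be kept off all rational hyperplanes (linear independence) and
  off any given sequence of points (uncountability).\<close>

section \<open>Matrix rank and distances from multiples of a real number to the integers\<close>

text \<open>Outside columns \<open>k\<close> and \<open>l\<close> the matrix agrees with an outer
  product, and restoring each of these columns raises the rank by at most one.\<close>

lemma rank_le_3_of_proportional_columns:
  fixes M :: "real mat"
  assumes M: "M \<in> carrier_mat n n"
    and proportional: "\<And>i j. \<lbrakk>i < n; j < n; j \<noteq> k; j \<noteq> l\<rbrakk> \<Longrightarrow> M $$ (i, j) = f i * g j"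
  shows "vec_space.rank n M \<le> 3"
proof -
  interpret vec_space "TYPE(real)" n .
  define A where "A = mat n n (\<lambda>(i, j). f i * (if j = k \<or> j = l then 0 else g j))"
  define B where "B = mat n n (\<lambda>(i, j). M $$ (i, k) * (if j = k then 1 else 0))"
  \<comment> \<open>The condition \<open>l \<noteq> k\<close> keeps the column from being counted
    twice when \<open>k = l\<close>.\<close>
  define C where "C = mat n n (\<lambda>(i, j). M $$ (i, l) * (if j = l \<and> l \<noteq> k then 1 else 0))"
  have dims: "A \<in> carrier_mat n n" "B \<in> carrier_mat n n" "C \<in> carrier_mat n n"
    by (auto simp: A_def B_def C_def)
  have "rank A \<le> 1"
    by (rule rank_le_1_product_entries[OF dims(1), of "\<lambda>i. f i" "\<lambda>j. if j = k \<or> j = l then 0 else g j"])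
      (auto simp: A_def)
  moreover have "rank B \<le> 1"
    by (rule rank_le_1_product_entries[OF dims(2), of "\<lambda>i. M $$ (i, k)" "\<lambda>j. if j = k then 1 else 0"])
      (auto simp: B_def)
  moreover have "rank C \<le> 1"
    by (rule rank_le_1_product_entries[OF dims(3), of "\<lambda>i. M $$ (i, l)"
          "\<lambda>j. if j = l \<and> l \<noteq> k then 1 else 0"])
      (auto simp: C_def)
  moreover have "rank (A + B + C) \<le> rank A + rank B + rank C"
    using rank_subadditive[of "A + B" n C] rank_subadditive[of A n B] dims by fastforce
  moreover have "M = A + B + C"
    using M proportional by (intro eq_matI) (auto simp: A_def B_def C_def)
  ultimately show ?thesis by simp
qed

text \<open>If \<open>x j\<close> has denominator \<open>v\<close>, every \<open>p * x j - a\<close>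
  is a multiple of \<open>1 / v\<close>. The minimum over finitely many \<open>j\<close> serves all
  rational coordinates at once.\<close>

lemma rational_multiples_gap:
  fixes x :: "nat \<Rightarrow> real"
  obtains c where "0 < c" "c \<le> 1"
    "\<And>j p a. \<lbrakk>j < (n::nat); x j \<in> \<rat>; of_int p * x j \<noteq> of_int a\<rbrakk> \<Longrightarrow> c \<le> \<bar>of_int p * x j - of_int a\<bar>"
proof -
  have single: "\<exists>c>0. \<forall>p a. of_int p * x j \<noteq> of_int a \<longrightarrow> c \<le> \<bar>of_int p * x j - of_int a\<bar>"
    if "x j \<in> \<rat>" for j
  proof -
    from that obtain u v :: int where v: "v > 0" and uv: "x j = of_int u / of_int v"
      by (elim Rats_cases')
    have "1 / of_int v \<le> \<bar>of_int p * x j - of_int a\<bar>" if ne: "of_int p * x j \<noteq> of_int a" for p a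
    proof -
      have eq: "of_int p * x j - of_int a = of_int (p * u - a * v) / of_int v"
        using v by (simp add: uv field_simps)
      have "p * u - a * v \<noteq> 0"
      proof
        assume "p * u - a * v = 0"
        with eq ne show False by simp
      qed
      then have "(1::real) \<le> \<bar>of_int (p * u - a * v)\<bar>" by linarith
      then show ?thesis unfolding eq using v by (simp add: divide_right_mono)
    qed
    with v show ?thesis by (intro exI[of _ "1 / of_int v"]) auto
  qed
  have "\<exists>c. 0 < c \<and> c \<le> 1 \<and> (\<forall>j<n. x j \<in> \<rat> \<longrightarrow>
      (\<forall>p a. of_int p * x j \<noteq> of_int a \<longrightarrow> c \<le> \<bar>of_int p * x j - of_int a\<bar>))"
  proof (induction n)
    case 0
    show ?case by (rule exI[of _ 1]) simp
  next
    case (Suc n)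
    then obtain c where c: "0 < c" "c \<le> 1" "\<And>j p a. \<lbrakk>j < n; x j \<in> \<rat>; of_int p * x j \<noteq> of_int a\<rbrakk>
        \<Longrightarrow> c \<le> \<bar>of_int p * x j - of_int a\<bar>" by blast
    show ?case
    proof (cases "x n \<in> \<rat>")
      case True
      with single[of n] obtain d where "0 < d"
        "\<And>p a. of_int p * x n \<noteq> of_int a \<Longrightarrow> d \<le> \<bar>of_int p * x n - of_int a\<bar>" by blast
      with c show ?thesis
        by (intro exI[of _ "min c d"]) (auto simp: less_Suc_eq min_le_iff_disj)
    next
      case False
      with c show ?thesis by (intro exI[of _ c]) (auto simp: less_Suc_eq)
    qed
  qed
  with that show ?thesis by blast
qed

text \<open>Only finitely many \<open>q\<close> occur, and none of them makes \<open>q * t\<close>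
  an integer. The cap \<open>1/2\<close> later rules out two good integer vectors with the same
  first entry.\<close>

lemma irrational_multiples_gap:
  fixes t :: real
  assumes "t \<notin> \<rat>"
  obtains m where "0 < m" "m \<le> 1/2"
    "\<And>q b::int. \<lbrakk>1 \<le> q; q \<le> int P\<rbrakk> \<Longrightarrow> m \<le> \<bar>of_int q * t - of_int b\<bar>"
proof -
  have "\<exists>m. 0 < m \<and> m \<le> 1/2 \<and> (\<forall>q b::int. 1 \<le> q \<longrightarrow> q \<le> int P \<longrightarrow> m \<le> \<bar>of_int q * t - of_int b\<bar>)"
  proof (induction P)
    case 0
    show ?case by (rule exI[of _ "1/2"]) auto
  next
    case (Suc P)
    then obtain m where m: "0 < m" "m \<le> 1/2"
      "\<And>q b::int. \<lbrakk>1 \<le> q; q \<le> int P\<rbrakk> \<Longrightarrow> m \<le> \<bar>of_int q * t - of_int b\<bar>" by blast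
    let ?y = "of_int (int (Suc P)) * t"
    have "?y \<noteq> of_int b" for b
    proof
      assume "?y = of_int b"
      then have "t = of_int b / of_int (int (Suc P))" by (simp add: field_simps)
      with assms show False by (metis Rats_divide Rats_of_int)
    qed
    then have pos: "0 < \<bar>?y - of_int (round ?y)\<bar>" by simp
    have near: "\<bar>?y - of_int (round ?y)\<bar> \<le> \<bar>?y - of_int b\<bar>" for b
      using round_diff_minimal[of ?y b] by (simp add: abs_minus_commute)
    have "min m \<bar>?y - of_int (round ?y)\<bar> \<le> \<bar>of_int q * t - of_int b\<bar>"
      if "1 \<le> q" "q \<le> int (Suc P)" for q b :: int
    proof (cases "q = int (Suc P)")
      case True
      with near[of b] show ?thesis unfolding min_le_iff_disj by blast
    next
      case False
      with that m(3)[of q b] show ?thesis by (simp add: min_le_iff_disj)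
    qed
    moreover have "min m \<bar>?y - of_int (round ?y)\<bar> \<le> 1/2"
      using m(2) by (rule min.coboundedI1)
    ultimately show ?case
      using m(1) pos by (meson min_less_iff_conj)
  qed
  with that show ?thesis by blast
qed

lemma exists_irrational_avoiding:
  fixes a b :: real
  assumes "a < b" "countable S"
  obtains t where "a < t" "t < b" "t \<notin> \<rat>" "t \<notin> S"
proof -
  have "uncountable ({a<..<b} - (\<rat> \<union> S))"
    using assms countable_rat by (intro uncountable_minus_countable) (auto simp: uncountable_open_interval)
  then obtain t where "t \<in> {a<..<b} - (\<rat> \<union> S)"
    by (metis countable_empty ex_in_conv)
  with that show ?thesis by auto
qed

lemma bsa_unique:
  assumes "bsa \<alpha> p a" "bsa \<alpha> p b"
  shows "a = b"
  using assms unfolding bsa_def by (metis less_asym order_refl)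

text \<open>One step of the construction: the limit stays within \<open>radius\<close> of
  \<open>centre\<close>, best approximations are guaranteed for \<open>p\<close> between
  \<open>lo\<close> and \<open>hi\<close>, and \<open>gap\<close> separates points outside the
  subspace from the centre.\<close>

record stage =
  centre :: "nat \<Rightarrow> real"
  radius :: real
  lo :: nat
  hi :: nat
  gap :: real

context
  fixes s :: nat
  assumes s_pos: "0 < s"
begin

section \<open>Distances, boxes and best approximations that survive perturbation\<close>

abbreviation D :: "(nat \<Rightarrow> real) \<Rightarrow> int \<Rightarrow> int list \<Rightarrow> real" where
  "D x \<equiv> Dist (map x [0..<s])"

abbreviation best :: "(nat \<Rightarrow> real) \<Rightarrow> int \<Rightarrow> int list \<Rightarrow> bool" where
  "best x \<equiv> bsa (map x [0..<s])"

definition box :: "(nat \<Rightarrow> real) \<Rightarrow> real \<Rightarrow> (nat \<Rightarrow> real) set" where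
  "box x \<delta> = {y. \<forall>j<s. \<bar>y j - x j\<bar> \<le> \<delta>}"

lemma box_mono: "\<delta> \<le> \<epsilon> \<Longrightarrow> box x \<delta> \<subseteq> box x \<epsilon>"
  by (auto simp: box_def intro: order_trans)

lemma D_less_iff: "D x p a < c \<longleftrightarrow> (\<forall>j<s. \<bar>of_int p * x j - of_int (a ! j)\<bar> < c)"
proof -
  have "D x p a = Max ((\<lambda>j. \<bar>of_int p * x j - of_int (a ! j)\<bar>) ` {..<s})"
    unfolding Dist_def by (intro arg_cong[of _ _ Max] image_cong) auto
  moreover have "(\<lambda>j. \<bar>of_int p * x j - of_int (a ! j)\<bar>) ` {..<s} \<noteq> {}"
    using s_pos by auto
  ultimately show ?thesis by auto
qed

lemma D_le_iff: "D x p a \<le> c \<longleftrightarrow> (\<forall>j<s. \<bar>of_int p * x j - of_int (a ! j)\<bar> \<le> c)"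
proof -
  have "D x p a = Max ((\<lambda>j. \<bar>of_int p * x j - of_int (a ! j)\<bar>) ` {..<s})"
    unfolding Dist_def by (intro arg_cong[of _ _ Max] image_cong) auto
  moreover have "(\<lambda>j. \<bar>of_int p * x j - of_int (a ! j)\<bar>) ` {..<s} \<noteq> {}"
    using s_pos by auto
  ultimately show ?thesis by auto
qed

lemma coord_le_D: "j < s \<Longrightarrow> \<bar>of_int p * x j - of_int (a ! j)\<bar> \<le> D x p a"
  using D_le_iff[of x p a "D x p a"] by simp

text \<open>The bound uses \<open>p\<close> rather than \<open>q\<close>, so that one estimate
  serves all competitors \<open>q \<le> p\<close>.\<close>

lemma D_perturb:
  assumes "y \<in> box x \<delta>" "0 \<le> q" "q \<le> p"
  shows "\<bar>D y q a - D x q a\<bar> \<le> of_int p * \<delta>"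
proof -
  have move: "\<bar>of_int q * y j - of_int q * x j\<bar> \<le> of_int p * \<delta>" if "j < s" for j
  proof -
    have j: "\<bar>y j - x j\<bar> \<le> \<delta>" using assms(1) that by (simp add: box_def)
    have "\<bar>of_int q * y j - of_int q * x j\<bar> = of_int q * \<bar>y j - x j\<bar>"
      using assms(2) by (simp add: abs_mult flip: right_diff_distrib)
    also have "\<dots> \<le> of_int p * \<delta>"
      using j assms by (intro mult_mono) auto
    finally show ?thesis .
  qed
  have "D y q a \<le> D x q a + of_int p * \<delta>"
    unfolding D_le_iff using move coord_le_D[of _ q x a] by (smt (verit, best))
  moreover have "D x q a \<le> D y q a + of_int p * \<delta>"
    unfolding D_le_iff using move coord_le_D[of _ q y a] by (smt (verit, best))
  ultimately show ?thesis by linarith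
qed

lemma ex_small_D:
  assumes "0 < \<epsilon>"
  obtains q b where "1 \<le> q" "length b = s" "D x q b < \<epsilon>"
proof -
  obtain N where N: "1 / real (Suc N) < \<epsilon>"
    using nat_approx_posE[OF assms] by blast
  obtain q p where "0 < q" and p: "\<And>i. i < s \<Longrightarrow> \<bar>of_int q * x i - of_int (p i)\<bar> < 1 / real (Suc N)"
    using Dirichlet_approx_simult[of "Suc N" s x] by (metis zero_less_Suc)
  moreover have "D x q (map p [0..<s]) < \<epsilon>"
    unfolding D_less_iff using p N by fastforce
  ultimately show ?thesis
    using that[of q "map p [0..<s]"] by simp
qed

text \<open>Rounding each \<open>p * x j\<close> gives a competitor with the same
  \<open>p\<close>.\<close>

lemma best_D_le_half:
  assumes "best x p a"
  shows "D x p a \<le> 1/2"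
proof -
  define b where "b = map (\<lambda>j. round (of_int p * x j)) [0..<s]"
  have b: "D x p b \<le> 1/2"
    unfolding D_le_iff b_def using of_int_round_abs_le by (fastforce simp: abs_minus_commute)
  show ?thesis
  proof (cases "b = a")
    case False
    then have "D x p a < D x p b"
      using assms by (simp add: bsa_def b_def)
    with b show ?thesis by simp
  qed (use b in simp)
qed

text \<open>Let \<open>m\<close> be a lower bound for the distances in coordinate \<open>i\<close>
  up to \<open>P\<close>. The first \<open>p\<close> at which some integer vector comes closer than
  \<open>m\<close> exceeds \<open>P\<close> and beats all its competitors by a positive
  margin.\<close>

lemma robust_best_beyond:
  assumes i: "i < s" "x i \<notin> \<rat>"
  obtains p a \<delta> where "P < p" "0 < \<delta>" "\<And>y. y \<in> box x \<delta> \<Longrightarrow> best y (int p) a"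
proof -
  obtain m where m: "0 < m" "m \<le> 1/2"
    "\<And>q b::int. \<lbrakk>1 \<le> q; q \<le> int P\<rbrakk> \<Longrightarrow> m \<le> \<bar>of_int q * x i - of_int b\<bar>"
    using irrational_multiples_gap[OF i(2), of P] by blast
  define p where "p = (LEAST q. 1 \<le> q \<and> (\<exists>b. length b = s \<and> D x (int q) b < m))"
  obtain q0 b0 where "1 \<le> q0" "length b0 = s" "D x q0 b0 < m"
    using ex_small_D[OF m(1), of x] by metis
  then have "1 \<le> nat q0 \<and> (\<exists>b. length b = s \<and> D x (int (nat q0)) b < m)" by auto
  then have "1 \<le> p \<and> (\<exists>b. length b = s \<and> D x (int p) b < m)"
    unfolding p_def by (rule LeastI)
  then obtain a where p1: "1 \<le> p" and a: "length a = s" "D x (int p) a < m" by blast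
  have before: "m \<le> D x q b" if "1 \<le> q" "q < int p" "length b = s" for q b
  proof (rule ccontr)
    assume "\<not> m \<le> D x q b"
    with that have "p \<le> nat q"
      unfolding p_def by (intro Least_le) auto
    with that show False by linarith
  qed
  \<comment> \<open>Two vectors at the same \<open>p\<close> differ by at least 1 in some
    coordinate, so with \<open>m \<le> 1/2\<close> they cannot both be closer than
    \<open>m\<close>.\<close>
  have at_p: "m \<le> D x (int p) b" if "length b = s" "b \<noteq> a" for b
  proof -
    from that a obtain j where j: "j < s" "b ! j \<noteq> a ! j"
      by (metis nth_equalityI)
    then have "1 \<le> \<bar>real_of_int (b ! j) - of_int (a ! j)\<bar>" by linarith
    moreover have "\<bar>of_int (int p) * x j - of_int (a ! j)\<bar> < m"
      using a(2) j(1) D_less_iff by blast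
    ultimately show ?thesis
      using coord_le_D[OF j(1), of "int p" x b] m(2) by linarith
  qed
  have gap: "m \<le> D x q b" if "1 \<le> q" "q \<le> int p" "length b = s" "b \<noteq> a" for q b
    using before[of q b] at_p[of b] that by (cases "q = int p") auto
  have "P < p"
  proof (rule ccontr)
    assume "\<not> P < p"
    then have "m \<le> \<bar>of_int (int p) * x i - of_int (a ! i)\<bar>"
      using p1 by (intro m(3)) auto
    with coord_le_D[OF i(1), of "int p" x a] a(2) show False by linarith
  qed
  \<comment> \<open>All competitors are at distance at least \<open>m\<close>, which also excludes ties.\<close>
  define \<delta> where "\<delta> = (m - D x (int p) a) / (3 * real p)"
  have \<delta>: "0 < \<delta>" "real p * \<delta> = (m - D x (int p) a) / 3"
    using a(2) p1 by (auto simp: \<delta>_def)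
  have "best y (int p) a" if y: "y \<in> box x \<delta>" for y
  proof -
    \<comment> \<open>Each of the two distances moves by at most a third of the margin, so their
      strict order persists.\<close>
    have "D y (int p) a < D y q b" if "1 \<le> q" "q \<le> int p" "length b = s" "b \<noteq> a" for q b
      using D_perturb[OF y, of q "int p" b] D_perturb[OF y, of "int p" "int p" a] gap[of q b] \<delta>(2) a(2) that
      by auto argo
    then show ?thesis using p1 a(1) by (simp add: bsa_def)
  qed
  with \<open>P < p\<close> \<delta>(1) that show ?thesis by blast
qed

text \<open>Induction on \<open>m\<close>: the next robust best approximation is taken beyond all
  previous ones, and the box shrinks to the smaller radius.\<close>

lemma many_robust_best:
  assumes "i < s" "x i \<notin> \<rat>"
  obtains Q T \<delta> where "T \<subseteq> {P..Q}" "card T = m" "0 < \<delta>"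
    "\<And>y p. \<lbrakk>y \<in> box x \<delta>; p \<in> T\<rbrakk> \<Longrightarrow> \<exists>a. best y (int p) a"
proof -
  have "\<exists>Q T \<delta>. T \<subseteq> {P..Q} \<and> card T = m \<and> 0 < \<delta> \<and>
      (\<forall>y\<in>box x \<delta>. \<forall>p\<in>T. \<exists>a. best y (int p) a)"
  proof (induction m)
    case 0
    show ?case by (rule exI, rule exI[of _ "{}"], rule exI[of _ 1]) simp
  next
    case (Suc m)
    then obtain Q T \<delta> where T: "T \<subseteq> {P..Q}" "card T = m" "0 < \<delta>"
      "\<forall>y\<in>box x \<delta>. \<forall>p\<in>T. \<exists>a. best y (int p) a" by blast
    obtain p a \<epsilon> where p: "max P Q < p" "0 < \<epsilon>" "\<And>y. y \<in> box x \<epsilon> \<Longrightarrow> best y (int p) a"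
      using robust_best_beyond[OF assms(1), of x "max P Q", OF assms(2)] by metis
    have "finite T" "p \<notin> T" using T(1) p(1) by (auto intro: finite_subset)
    then have "card (insert p T) = Suc m" using T(2) by simp
    moreover have "insert p T \<subseteq> {P..p}" using T(1) p(1) by fastforce
    moreover have "\<forall>y\<in>box x (min \<delta> \<epsilon>). \<forall>r\<in>insert p T. \<exists>a. best y (int r) a"
      using T(4) p(3) box_mono[of "min \<delta> \<epsilon>" \<delta> x] box_mono[of "min \<delta> \<epsilon>" \<epsilon> x]
      by (auto simp: subset_iff) blast
    ultimately show ?case using T(3) p(2) by (metis min_less_iff_conj)
  qed
  with that show ?thesis by blast
qed


section \<open>Stages of the construction and the passage from one to the next\<close>

abbreviation free :: "nat \<Rightarrow> nat \<Rightarrow> bool" where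
  "free n j \<equiv> j = n mod s \<or> j = Suc n mod s"

text \<open>The last clause compensates for the condition \<open>b \<noteq> a\<close> in \<open>bsa\<close>, which does not compare
  \<open>(p, a)\<close> with \<open>(q, a)\<close> for \<open>q < p\<close>: once a coordinate is at least 1, these two points cannot both
  be good approximations.\<close>
definition valid :: "(nat \<Rightarrow> (nat \<Rightarrow> real) set) \<Rightarrow> nat \<Rightarrow> stage \<Rightarrow> bool" where
  "valid F n S \<longleftrightarrow>
     0 < radius S \<and> box (centre S) (radius S) \<inter> F n = {} \<and>
     centre S (n mod s) \<notin> \<rat> \<and> (\<forall>j<s. j \<noteq> n mod s \<longrightarrow> centre S j \<in> \<rat>) \<and>
     0 < gap S \<and> gap S \<le> 1 \<and>
     (\<forall>j<s. \<not> free n j \<longrightarrow> (\<forall>p a. of_int p * centre S j \<noteq> of_int a \<longrightarrow>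
        gap S \<le> \<bar>of_int p * centre S j - of_int a\<bar>)) \<and>
     (\<exists>q b. 1 \<le> q \<and> q \<le> int (lo S) \<and> length b = s \<and>
        (\<forall>y\<in>box (centre S) (radius S). D y q b < gap S / 2)) \<and>
     (\<exists>T\<subseteq>{lo S..hi S}. card T = s \<and>
        (\<forall>y\<in>box (centre S) (radius S). \<forall>p\<in>T. \<exists>a. best y (int p) a)) \<and>
     (\<forall>y\<in>box (centre S) (radius S). 1 \<le> y 0)"

text \<open>The last clause says that every integer point outside the subspace shared by the centres of \<open>S\<close>
  and \<open>S'\<close>, with first entry at most \<open>hi S'\<close>, is a bad approximation to every point of the smaller box.\<close>
definition linked :: "nat \<Rightarrow> stage \<Rightarrow> stage \<Rightarrow> bool" where
  "linked n S S' \<longleftrightarrow>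
     lo S < lo S' \<and>
     (\<forall>j<s. \<bar>centre S' j - centre S j\<bar> + radius S' \<le> radius S) \<and>
     (\<forall>y\<in>box (centre S') (radius S'). \<forall>p a j. 1 \<le> p \<longrightarrow> p \<le> int (hi S') \<longrightarrow> j < s \<longrightarrow> \<not> free n j \<longrightarrow>
        \<bar>of_int p * y j - of_int a\<bar> < gap S / 2 \<longrightarrow> of_int a = of_int p * centre S j)"

text \<open>Step \<open>n\<close> of the construction can only use direction \<open>n mod s\<close> to escape from \<open>F n\<close>.\<close>
definition avoidable :: "(nat \<Rightarrow> (nat \<Rightarrow> real) set) \<Rightarrow> bool" where
  "avoidable F \<longleftrightarrow>
     (\<forall>n x. x \<notin> F n \<longrightarrow> (\<exists>\<delta>>0. box x \<delta> \<inter> F n = {})) \<and>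
     (\<forall>n x. countable {t. x(n mod s := t) \<in> F n})"

text \<open>Everything required of the box holds with room to spare at \<open>x\<close>, so a small
  enough radius works.\<close>

lemma valid_stage_at:
  assumes F: "avoidable F" "x \<notin> F n"
    and x: "x (n mod s) \<notin> \<rat>" "\<forall>j<s. j \<noteq> n mod s \<longrightarrow> x j \<in> \<rat>" "1 < x 0"
    and c: "0 < c" "c \<le> 1" "\<forall>j<s. \<not> free n j \<longrightarrow> (\<forall>p a. of_int p * x j \<noteq> of_int a \<longrightarrow>
        c \<le> \<bar>of_int p * x j - of_int a\<bar>)"
    and q: "1 \<le> q" "q \<le> int P" "length b = s" "D x q b < c / 2"
    and pos: "0 < \<rho>" "0 < e"
  obtains S where "valid F n S" "centre S = x" "lo S = P" "gap S = c"
    "radius S \<le> \<rho>" "real (hi S) * radius S \<le> e"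
proof -
  have n: "n mod s < s" using s_pos by simp
  obtain \<delta>1 where \<delta>1: "0 < \<delta>1" "box x \<delta>1 \<inter> F n = {}"
    using F unfolding avoidable_def by blast
  obtain Q T \<delta>2 where T: "T \<subseteq> {P..Q}" "card T = s" "0 < \<delta>2"
    "\<And>y p. \<lbrakk>y \<in> box x \<delta>2; p \<in> T\<rbrakk> \<Longrightarrow> \<exists>a. best y (int p) a"
    using many_robust_best[OF n, of x P s, OF x(1)] by metis
  define \<delta>3 where "\<delta>3 = (c / 2 - D x q b) / (2 * of_int q)"
  have \<delta>3: "0 < \<delta>3" "of_int q * \<delta>3 < c / 2 - D x q b"
    using q by (auto simp: \<delta>3_def)
  \<comment> \<open>\<open>Q\<close>, the future \<open>hi\<close>, is fixed before the radius, so
    their product can be made as small as desired.\<close>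
  define \<delta>4 where "\<delta>4 = e / real (Suc Q)"
  have \<delta>4: "0 < \<delta>4" using pos by (simp add: \<delta>4_def)
  define \<delta> where "\<delta> = Min {\<delta>1, \<delta>2, \<delta>3, \<delta>4, x 0 - 1, \<rho>}"
  have \<delta>: "0 < \<delta>" "\<delta> \<le> \<delta>1" "\<delta> \<le> \<delta>2" "\<delta> \<le> \<delta>3" "\<delta> \<le> \<delta>4" "\<delta> \<le> x 0 - 1" "\<delta> \<le> \<rho>"
    using \<delta>1(1) T(3) \<delta>3(1) \<delta>4 x(3) pos by (auto simp: \<delta>_def)
  have sub: "box x \<delta> \<subseteq> box x \<delta>1" "box x \<delta> \<subseteq> box x \<delta>2" "box x \<delta> \<subseteq> box x \<delta>3"
    using \<delta> by (auto intro!: box_mono)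
  define S where "S = \<lparr>centre = x, radius = \<delta>, lo = P, hi = Q, gap = c\<rparr>"
  have "D y q b < c / 2" if "y \<in> box x \<delta>" for y
    using D_perturb[of y x \<delta>3 q q b] that sub(3) \<delta>3(2) q(1) by (auto simp: subset_iff)
  moreover have "1 \<le> y 0" if "y \<in> box x \<delta>" for y
    using that \<delta>(6) s_pos by (auto simp: box_def abs_le_iff)
  moreover have "\<forall>y\<in>box x \<delta>. \<forall>p\<in>T. \<exists>a. best y (int p) a"
    using T(4) sub(2) by blast
  ultimately have "valid F n S"
    unfolding valid_def S_def using \<delta>1(2) sub(1) \<delta>(1) x(1,2) c q T(1,2)
    by (simp, intro conjI) blast+
  moreover have "real Q * \<delta> \<le> e"
  proof -
    have "real Q * \<delta> \<le> real (Suc Q) * \<delta>4"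
      using \<delta> by (intro mult_mono) auto
    then show ?thesis by (simp add: \<delta>4_def)
  qed
  ultimately show ?thesis
    using that[of S] \<delta>(7) by (simp add: S_def)
qed

text \<open>The start is \<open>(t, 0, ..., 0)\<close> with \<open>t\<close> irrational in
  \<open>(1, 5/4)\<close>, approximated by the integer point \<open>(1, 1, 0, ..., 0)\<close>.
  Having \<open>lo = 1\<close> ensures that no best approximation precedes the first stage.\<close>

lemma valid_initial_stage:
  assumes F: "avoidable F"
  obtains S where "valid F 0 S" "lo S = 1"
proof -
  let ?z = "\<lambda>_::nat. 0::real"
  have "countable {t. ?z(0 mod s := t) \<in> F 0}"
    using F unfolding avoidable_def by blast
  then obtain t where t: "1 < t" "t < 5/4" "t \<notin> \<rat>" "?z(0 := t) \<notin> F 0"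
    using exists_irrational_avoiding[of 1 "5/4" "{t. ?z(0 mod s := t) \<in> F 0}"] by auto
  define x where "x = ?z(0 := t)"
  let ?b = "1 # replicate (s - 1) 0 :: int list"
  obtain S where "valid F 0 S" "lo S = 1"
  proof (rule valid_stage_at[OF F, of x 0 1 1 1 ?b 1 1])
    show "D x 1 ?b < 1/2"
      unfolding D_less_iff x_def using t by (auto simp: nth_Cons')
    show "\<forall>j<s. \<not> free 0 j \<longrightarrow> (\<forall>p a. of_int p * x j \<noteq> of_int a \<longrightarrow>
        1 \<le> \<bar>of_int p * x j - of_int a\<bar>)"
    proof (intro allI impI)
      fix j :: nat and p a :: int
      assume "\<not> free 0 j" "of_int p * x j \<noteq> of_int a"
      then have "x j = 0" "a \<noteq> 0" by (auto simp: x_def)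
      then show "1 \<le> \<bar>of_int p * x j - of_int a\<bar>" by simp
    qed
  qed (use t s_pos in \<open>auto simp: x_def\<close>)
  with that show ?thesis by blast
qed

text \<open>Only the two free coordinates move, so the gap of \<open>S\<close> still applies to the
  others. The new radius is chosen so small that multiples up to \<open>hi S'\<close> shift by at
  most half that gap.\<close>

lemma valid_next_stage:
  assumes F: "avoidable F" and S: "valid F n S" and s2: "2 \<le> s"
  obtains S' where "valid F (Suc n) S'" "linked n S S'"
proof -
  define x where "x = centre S"
  define \<delta> where "\<delta> = radius S"
  define g where "g = gap S"
  define i where "i = n mod s"
  define k where "k = Suc n mod s"
  have ik: "i < s" "k < s" using s_pos by (simp_all add: i_def k_def)
  have "i \<noteq> k" using s2 by (auto simp: i_def k_def mod_Suc)
  have \<delta>: "0 < \<delta>" and g: "0 < g"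
    and x_rat: "\<And>j. \<lbrakk>j < s; j \<noteq> i\<rbrakk> \<Longrightarrow> x j \<in> \<rat>"
    and x_gap: "\<And>j p a. \<lbrakk>j < s; \<not> free n j; of_int p * x j \<noteq> of_int a\<rbrakk> \<Longrightarrow> g \<le> \<bar>of_int p * x j - of_int a\<bar>"
    and x_0: "\<And>y. y \<in> box x \<delta> \<Longrightarrow> 1 \<le> y 0"
    using S unfolding valid_def x_def \<delta>_def g_def i_def by blast+
  obtain r where r: "r \<in> \<rat>" "x i - \<delta>/2 < r" "r < x i + \<delta>/2"
    using Rats_dense_in_real[of "x i - \<delta>/2" "x i + \<delta>/2"] \<delta> by auto
  have "countable {t. (x(i := r))(k := t) \<in> F (Suc n)}"
    using F unfolding avoidable_def k_def by blast
  then obtain t where t: "x k < t" "t < x k + \<delta>/2" "t \<notin> \<rat>" "(x(i := r))(k := t) \<notin> F (Suc n)"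
    using exists_irrational_avoiding[of "x k" "x k + \<delta>/2"] \<delta> by auto
  define x' where "x' = (x(i := r))(k := t)"
  have "\<bar>r - x i\<bar> \<le> \<delta>/2" "\<bar>t - x k\<bar> \<le> \<delta>/2" using r t by linarith+
  then have near: "\<bar>x' j - x j\<bar> \<le> \<delta>/2" for j
    using \<delta> by (auto simp: x'_def)
  \<comment> \<open>The lowest corner of the box satisfies the lower bound 1, which leaves
    \<open>x 0\<close> enough room for a move by \<open>\<delta>/2\<close>.\<close>
  have "(\<lambda>j. x j - \<delta>) \<in> box x \<delta>" using \<delta> by (simp add: box_def)
  then have "1 \<le> x 0 - \<delta>" using x_0 by fast
  then have "1 < x' 0" using near[of 0] \<delta> by linarith
  have x'_rat: "\<forall>j<s. j \<noteq> k \<longrightarrow> x' j \<in> \<rat>"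
    using x_rat r(1) by (auto simp: x'_def)
  obtain c where c: "0 < c" "c \<le> 1"
    "\<And>j p a. \<lbrakk>j < s; x' j \<in> \<rat>; of_int p * x' j \<noteq> of_int a\<rbrakk> \<Longrightarrow> c \<le> \<bar>of_int p * x' j - of_int a\<bar>"
    using rational_multiples_gap[of s x'] by metis
  obtain q b where q: "1 \<le> q" "length b = s" "D x' q b < c / 2"
    using ex_small_D[of "c / 2" x'] c(1) by auto
  \<comment> \<open>The value of \<open>lo S'\<close> makes \<open>lo\<close> strictly increase and
    places the good approximation \<open>(q, b)\<close> at or below it.\<close>
  obtain S' where S': "valid F (Suc n) S'" "centre S' = x'" "lo S' = max (Suc (lo S)) (nat q)"
    "radius S' \<le> \<delta> / 2" "real (hi S') * radius S' \<le> g / 2"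
  proof (rule valid_stage_at[OF F, of x' "Suc n" c q "max (Suc (lo S)) (nat q)" b "\<delta> / 2" "g / 2"])
    show "x' \<notin> F (Suc n)" using t by (simp add: x'_def)
    show "x' (Suc n mod s) \<notin> \<rat>" using t by (simp add: x'_def k_def)
    show "\<forall>j<s. j \<noteq> Suc n mod s \<longrightarrow> x' j \<in> \<rat>" using x'_rat by (simp add: k_def)
    show "\<forall>j<s. \<not> free (Suc n) j \<longrightarrow> (\<forall>p a. of_int p * x' j \<noteq> of_int a \<longrightarrow>
        c \<le> \<bar>of_int p * x' j - of_int a\<bar>)"
      using c(3) x'_rat by (simp add: k_def)
  qed (use \<open>1 < x' 0\<close> c q \<delta> g in auto)
  have "0 < radius S'" using S'(1) by (simp add: valid_def)
  have "of_int a = of_int p * x j"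
    if y: "y \<in> box x' (radius S')" and p: "1 \<le> p" "p \<le> int (hi S')" and j: "j < s" "\<not> free n j"
      and small: "\<bar>of_int p * y j - of_int a\<bar> < g / 2" for y j and p a :: int
  proof (rule ccontr)
    assume "of_int a \<noteq> of_int p * x j"
    then have "g \<le> \<bar>of_int p * x j - of_int a\<bar>" using x_gap[OF j, of p a] by auto
    moreover have "\<bar>of_int p * y j - of_int p * x j\<bar> \<le> g / 2"
    proof -
      have "\<bar>of_int p * y j - of_int p * x j\<bar> = of_int p * \<bar>y j - x' j\<bar>"
        using p(1) j(2) by (simp add: abs_mult x'_def i_def k_def flip: right_diff_distrib)
      also have "\<dots> \<le> real (hi S') * radius S'"
        using y p j(1) by (intro mult_mono) (auto simp: box_def)
      finally show ?thesis using S'(5) by linarith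
    qed
    ultimately show False using small by linarith
  qed
  moreover have "\<bar>x' j - x j\<bar> + radius S' \<le> \<delta>" for j
    using near[of j] S'(4) by linarith
  ultimately have "linked n S S'"
    unfolding linked_def using S'(2,3) by (auto simp: x_def \<delta>_def g_def)
  with S'(1) that show ?thesis by blast
qed

lemma valid_stage_sequence:
  assumes "avoidable F" "2 \<le> s"
  obtains S where "\<And>n. valid F n (S n)" "\<And>n. linked n (S n) (S (Suc n))" "lo (S 0) = 1"
proof -
  have "\<exists>S. \<forall>n. (valid F n (S n) \<and> (n = 0 \<longrightarrow> lo (S n) = 1)) \<and> linked n (S n) (S (Suc n))"
  proof (rule dependent_nat_choice)
    show "\<exists>S. valid F 0 S \<and> (0 = (0::nat) \<longrightarrow> lo S = 1)"
      using valid_initial_stage[OF assms(1)] by blast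
  qed (metis valid_next_stage[OF assms(1) _ assms(2)] nat.distinct(1))
  with that show ?thesis by blast
qed

section \<open>The limit point and its best approximations\<close>

text \<open>Nested closed intervals in each coordinate; the supremum of the left ends lies in all of
  them.\<close>

lemma limit_of_linked_stages:
  assumes pos: "\<And>n. 0 < radius (S n)" and link: "\<And>n. linked n (S n) (S (Suc n))"
  obtains x where "\<And>n. x \<in> box (centre (S n)) (radius (S n))"
proof -
  define l where "l n j = centre (S n) j - radius (S n)" for n j
  define u where "u n j = centre (S n) j + radius (S n)" for n j
  have step: "l n j \<le> l (Suc n) j" "u (Suc n) j \<le> u n j" if "j < s" for n j
    using link[of n] that unfolding linked_def l_def u_def by (smt (verit))+
  have lu: "l m j \<le> u n j" if "j < s" for m n j
  proof -
    have "l m j \<le> l (max m n) j"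
      using step(1)[OF that] by (rule lift_Suc_mono_le) simp
    also have "\<dots> \<le> u (max m n) j" using pos[of "max m n"] by (simp add: l_def u_def)
    also have "\<dots> \<le> u n j"
      using step(2)[OF that] by (rule lift_Suc_antimono_le) simp
    finally show ?thesis .
  qed
  define x where "x j = (SUP n. l n j)" for j
  have "x \<in> box (centre (S n)) (radius (S n))" for n
  proof -
    have "l n j \<le> x j" "x j \<le> u n j" if "j < s" for j
      unfolding x_def using lu[OF that] by (auto intro!: cSUP_upper cSUP_least bdd_aboveI)
    then show ?thesis by (fastforce simp: box_def l_def u_def abs_le_iff)
  qed
  with that show ?thesis by blast
qed

text \<open>The stage supplies some \<open>(q, b)\<close> with \<open>q \<le> lo S\<close> and
  distance below \<open>gap S / 2\<close>. A best approximation from \<open>lo S\<close> on must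
  also get below this, and then \<open>linked\<close> applies.\<close>

lemma best_in_coordinate_space:
  assumes S: "valid F n S" and link: "linked n S S'"
    and y: "y \<in> box (centre S) (radius S)" "y \<in> box (centre S') (radius S')"
    and p: "best y p a" "int (lo S) \<le> p" "p \<le> int (hi S')"
    and j: "j < s" "\<not> free n j"
  shows "of_int (a ! j) = of_int p * centre S j"
proof -
  obtain q b where q: "1 \<le> q" "q \<le> int (lo S)" "length b = s" "D y q b < gap S / 2"
    using S y(1) unfolding valid_def by blast
  have gap1: "gap S \<le> 1" and y0: "1 \<le> y 0" using S y(1) unfolding valid_def by blast+
  have "D y p a < gap S / 2"
  proof (cases "b = a")
    case False
    then have "D y p a < D y q b"
      using p q unfolding bsa_def by auto
    with q(4) show ?thesis by simp
  next
    \<comment> \<open>If \<open>q < p\<close>, then \<open>p * y 0\<close> and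
      \<open>q * y 0\<close> differ by at least 1, yet both are within \<open>1/2\<close> of
      \<open>a ! 0\<close>, the second strictly.\<close>
    case True
    have "q = p"
    proof (rule ccontr)
      assume "q \<noteq> p"
      with q p have "q + 1 \<le> p" by linarith
      then have "1 * 1 \<le> (of_int p - of_int q) * y 0"
        using y0 by (intro mult_mono) linarith+
      moreover have "\<bar>of_int p * y 0 - of_int (a ! 0)\<bar> \<le> 1/2"
        using best_D_le_half[OF p(1)] coord_le_D[OF s_pos, of p y a] by linarith
      moreover have "\<bar>of_int q * y 0 - of_int (a ! 0)\<bar> < 1/2"
        using q(4) gap1 coord_le_D[OF s_pos, of q y a] unfolding True by linarith
      ultimately show False by (simp add: left_diff_distrib abs_le_iff abs_less_iff)
    qed
    with True q(4) show ?thesis by simp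
  qed
  then have "\<bar>of_int p * y j - of_int (a ! j)\<bar> < gap S / 2"
    using coord_le_D[OF j(1), of p y a] by linarith
  moreover have "1 \<le> p" using p(1) by (simp add: bsa_def)
  ultimately show ?thesis using link y(2) p(3) j unfolding linked_def by blast
qed

text \<open>The window starts at or after \<open>lo (S n)\<close> for the last possible
  \<open>n\<close>. The \<open>s\<close> best approximations guaranteed by stage
  \<open>Suc n\<close> force it to end by \<open>hi (S (Suc n))\<close>, so the subspace shared by
  these two stages contains it.\<close>

lemma consecutive_best_in_coordinate_space:
  assumes S: "\<And>n. valid F n (S n)" and link: "\<And>n. linked n (S n) (S (Suc n))" and lo0: "lo (S 0) = 1"
    and x: "\<And>n. x \<in> box (centre (S n)) (radius (S n))"
  defines "E \<equiv> {p. \<exists>a. best x (int p) a}"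
  shows "infinite E"
    and "\<exists>n. \<forall>i\<le>s. \<forall>a j. best x (int (enumerate E (\<nu> + i))) a \<longrightarrow> j < s \<longrightarrow> \<not> free n j \<longrightarrow>
      of_int (a ! j) = of_int (int (enumerate E (\<nu> + i))) * centre (S n) j"
proof -
  have "strict_mono (\<lambda>n. lo (S n))"
    using link by (auto simp: strict_mono_Suc_iff linked_def)
  then have lo_ge: "n \<le> lo (S n)" for n
    using strict_mono_imp_increasing by blast
  have block: "\<exists>T\<subseteq>{lo (S n)..hi (S n)} \<inter> E. card T = s" for n
  proof -
    obtain T where T: "T \<subseteq> {lo (S n)..hi (S n)}" "card T = s"
      "\<And>y. y \<in> box (centre (S n)) (radius (S n)) \<Longrightarrow> \<forall>p\<in>T. \<exists>a. best y (int p) a"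
      using S[of n] unfolding valid_def by blast
    from T(3)[OF x] have "T \<subseteq> E" unfolding E_def by blast
    with T(1,2) show ?thesis by blast
  qed
  show inf: "infinite E"
    unfolding infinite_nat_iff_unbounded_le
  proof
    fix m
    obtain T where "T \<subseteq> {lo (S m)..hi (S m)} \<inter> E" "card T = s" using block by blast
    moreover from this obtain p where "p \<in> T" using s_pos by fastforce
    ultimately show "\<exists>p\<ge>m. p \<in> E" using lo_ge[of m] by (intro exI[of _ p]) auto
  qed
  define e where "e = enumerate E"
  have mono: "strict_mono e" and range: "range e = E"
    using inf by (simp_all add: e_def strict_mono_enumerate range_enumerate)
  have "e \<nu> \<in> E" using range by blast
  then have "1 \<le> e \<nu>" by (auto simp: E_def bsa_def)
  define n where "n = (GREATEST n. lo (S n) \<le> e \<nu>)"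
  have bound: "\<And>n. lo (S n) \<le> e \<nu> \<Longrightarrow> n \<le> e \<nu>" using lo_ge order_trans by blast
  have n: "lo (S n) \<le> e \<nu>"
    unfolding n_def
    by (rule GreatestI_nat[of "\<lambda>n. lo (S n) \<le> e \<nu>" 0 "e \<nu>"]) (use \<open>1 \<le> e \<nu>\<close> lo0 bound in auto)
  have n': "e \<nu> < lo (S (Suc n))"
  proof (rule ccontr)
    assume "\<not> ?thesis"
    then have "lo (S (Suc n)) \<le> e \<nu>" by simp
    then have "Suc n \<le> n"
      unfolding n_def by (rule Greatest_le_nat) (rule bound)
    then show False by simp
  qed
  \<comment> \<open>Otherwise \<open>s\<close> elements of \<open>E\<close> would lie strictly
    between \<open>e \<nu>\<close> and \<open>e (\<nu> + s)\<close>, where there are only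
    \<open>s - 1\<close>.\<close>
  have last: "e (\<nu> + s) \<le> hi (S (Suc n))"
  proof (rule ccontr)
    assume gt: "\<not> ?thesis"
    obtain T where T: "T \<subseteq> {lo (S (Suc n))..hi (S (Suc n))} \<inter> E" "card T = s"
      using block by blast
    have "T \<subseteq> e ` {\<nu><..<\<nu> + s}"
    proof
      fix p assume p: "p \<in> T"
      then obtain m where m: "p = e m" using T(1) range by blast
      have "e \<nu> < e m" "e m < e (\<nu> + s)" using p T(1) n' gt m by auto
      with m show "p \<in> e ` {\<nu><..<\<nu> + s}" using mono by (auto simp: strict_mono_less)
    qed
    then have "card T \<le> card {\<nu><..<\<nu> + s}" by (rule surj_card_le[rotated]) simp
    with T(2) s_pos show False by simp
  qed
  show "\<exists>n. \<forall>i\<le>s. \<forall>a j. best x (int (enumerate E (\<nu> + i))) a \<longrightarrow> j < s \<longrightarrow> \<not> free n j \<longrightarrow>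
      of_int (a ! j) = of_int (int (enumerate E (\<nu> + i))) * centre (S n) j"
  proof (intro exI[of _ n] allI impI, fold e_def)
    fix i a j
    assume i: "i \<le> s" and a: "best x (int (e (\<nu> + i))) a" and j: "j < s" "\<not> free n j"
    have "e \<nu> \<le> e (\<nu> + i)" "e (\<nu> + i) \<le> e (\<nu> + s)"
      using mono i by (simp_all add: strict_mono_less_eq)
    then show "of_int (a ! j) = of_int (int (e (\<nu> + i))) * centre (S n) j"
      using n last by (intro best_in_coordinate_space[OF S link x x a _ _ j]) auto
  qed
qed

text \<open>Off the two free columns, row \<open>i\<close> is its first entry times the fixed row
  \<open>(1, r 0, r 1, ...)\<close>. Column indices are shifted by one because column 0 holds
  \<open>p\<close>.\<close>

lemma M_mat_rank_le_3:
  fixes r :: "nat \<Rightarrow> real"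
  assumes inf: "infinite {p. \<exists>a. best x (int p) a}" and \<nu>: "1 \<le> \<nu>"
    and proportional: "\<forall>i\<le>s. \<forall>a j. best x (int (enumerate {p. \<exists>a. best x (int p) a} (\<nu> - 1 + i))) a \<longrightarrow>
      j < s \<longrightarrow> \<not> free n j \<longrightarrow>
      of_int (a ! j) = of_int (int (enumerate {p. \<exists>a. best x (int p) a} (\<nu> - 1 + i))) * r j"
  shows "vec_space.rank (s + 1) (M_mat (map x [0..<s]) \<nu>) \<le> 3"
proof (rule rank_le_3_of_proportional_columns[where f = "\<lambda>i. of_int (bsa_p (map x [0..<s]) (\<nu> + i))"
      and g = "\<lambda>j. if j = 0 then 1 else r (j - 1)" and k = "Suc (n mod s)" and l = "Suc (Suc n mod s)"])
  let ?\<alpha> = "map x [0..<s]" and ?E = "{p. \<exists>a. best x (int p) a}"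
  show "M_mat ?\<alpha> \<nu> \<in> carrier_mat (s + 1) (s + 1)" by (simp add: M_mat_def)
  fix i j
  assume i: "i < s + 1" and j: "j < s + 1" "j \<noteq> Suc (n mod s)" "j \<noteq> Suc (Suc n mod s)"
  have p: "bsa_p ?\<alpha> (\<nu> + i) = int (enumerate ?E (\<nu> - 1 + i))"
    using \<nu> by (simp add: bsa_p_def)
  obtain a where a: "best x (bsa_p ?\<alpha> (\<nu> + i)) a"
    unfolding p using enumerate_in_set[OF inf] by blast
  then have a_eq: "bsa_a ?\<alpha> (\<nu> + i) = a"
    unfolding bsa_a_def using bsa_unique by blast
  show "M_mat ?\<alpha> \<nu> $$ (i, j) = of_int (bsa_p ?\<alpha> (\<nu> + i)) * (if j = 0 then 1 else r (j - 1))"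
  proof (cases j)
    case 0
    with i show ?thesis by (simp add: M_mat_def)
  next
    case (Suc m)
    then have "of_int (a ! m) = of_int (bsa_p ?\<alpha> (\<nu> + i)) * r m"
      using proportional a i j unfolding p by auto
    with Suc i j a_eq show ?thesis by (simp add: M_mat_def)
  qed
qed

lemma ex_degenerate_avoiding:
  assumes F: "avoidable F" and s2: "2 \<le> s"
  obtains x where "\<And>n. x \<notin> F n"
    "\<And>\<nu>. 1 \<le> \<nu> \<Longrightarrow> vec_space.rank (s + 1) (M_mat (map x [0..<s]) \<nu>) \<le> 3"
proof -
  obtain S where S: "\<And>n. valid F n (S n)" and link: "\<And>n. linked n (S n) (S (Suc n))" and lo: "lo (S 0) = 1"
    using valid_stage_sequence[OF F s2] by blast
  have "\<And>n. 0 < radius (S n)" using S by (simp add: valid_def)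
  then obtain x where x: "\<And>n. x \<in> box (centre (S n)) (radius (S n))"
    using limit_of_linked_stages[OF _ link] by blast
  note window = consecutive_best_in_coordinate_space[OF S link lo x]
  have "vec_space.rank (s + 1) (M_mat (map x [0..<s]) \<nu>) \<le> 3" if "1 \<le> \<nu>" for \<nu>
    using window(2)[of "\<nu> - 1"] M_mat_rank_le_3[OF window(1) that] by blast
  moreover have "x \<notin> F n" for n
    using S[of n] x[of n] unfolding valid_def by blast
  ultimately show ?thesis using that by blast
qed

section \<open>Avoiding rational hyperplanes and prescribed points\<close>

text \<open>Requiring \<open>c ! k \<noteq> 0\<close> makes every line in direction \<open>k\<close>
  meet the set at most once, so a change of coordinate \<open>k\<close> can escape it.\<close>

definition hyperplane :: "int \<Rightarrow> int list \<Rightarrow> nat \<Rightarrow> (nat \<Rightarrow> real) set" where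
  "hyperplane c0 c k = {x. c ! k \<noteq> 0 \<and> of_int c0 + (\<Sum>j<s. of_int (c ! j) * x j) = 0}"

text \<open>\<open>n div s\<close> selects the hyperplane and the point, \<open>n mod s\<close> the
  direction. Both sets are closed, and a line in that direction meets each at most once.\<close>

lemma avoidable_hyperplanes_and_points:
  fixes h :: "nat \<Rightarrow> int \<times> int list" and \<beta> :: "nat \<Rightarrow> real list"
  shows "avoidable (\<lambda>n. hyperplane (fst (h (n div s))) (snd (h (n div s))) (n mod s)
    \<union> {x. map x [0..<s] = \<beta> (n div s)})"
  unfolding avoidable_def
proof (intro conjI allI impI)
  fix n and x :: "nat \<Rightarrow> real"
  define k where "k = n mod s"
  obtain c0 c where hc: "h (n div s) = (c0, c)" by fastforce
  have k: "k < s" using s_pos by (simp add: k_def)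
  let ?H = "hyperplane c0 c k" and ?B = "{x. map x [0..<s] = \<beta> (n div s)}"
  define L where "L y = of_int c0 + (\<Sum>j<s. of_int (c ! j) * y j)" for y :: "nat \<Rightarrow> real"
  have H: "?H = {y. c ! k \<noteq> 0 \<and> L y = 0}" by (simp add: hyperplane_def L_def)
  {
    assume "x \<notin> hyperplane (fst (h (n div s))) (snd (h (n div s))) (n mod s) \<union> ?B"
    then have xH: "x \<notin> ?H" and xB: "map x [0..<s] \<noteq> \<beta> (n div s)"
      by (auto simp: hc k_def)
    have "\<exists>\<delta>>0. box x \<delta> \<inter> ?H = {}"
    proof (cases "c ! k = 0")
      case False
      define C where "C = (\<Sum>j<s. \<bar>real_of_int (c ! j)\<bar>)"
      have C: "0 \<le> C" by (simp add: C_def sum_nonneg)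
      \<comment> \<open>\<open>L\<close> changes by at most \<open>C * \<delta>\<close> on the box;
        \<open>C + 1\<close> keeps this strictly below \<open>\<bar>L x\<bar>\<close>.\<close>
      define \<delta> where "\<delta> = \<bar>L x\<bar> / (C + 1)"
      have "L x \<noteq> 0" using xH False by (simp add: H)
      then have \<delta>: "0 < \<delta>" "C * \<delta> < \<bar>L x\<bar>" using C by (auto simp: \<delta>_def field_simps)
      have "L y \<noteq> 0" if "y \<in> box x \<delta>" for y
      proof -
        have "\<bar>L y - L x\<bar> = \<bar>\<Sum>j<s. of_int (c ! j) * (y j - x j)\<bar>"
          by (simp add: L_def sum_subtractf right_diff_distrib)
        also have "\<dots> \<le> (\<Sum>j<s. \<bar>of_int (c ! j)\<bar> * \<bar>y j - x j\<bar>)"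
          using sum_abs by (simp flip: abs_mult)
        also have "\<dots> \<le> (\<Sum>j<s. \<bar>of_int (c ! j)\<bar> * \<delta>)"
          using that by (intro sum_mono mult_left_mono) (auto simp: box_def)
        also have "\<dots> = C * \<delta>" by (simp add: C_def sum_distrib_right)
        finally show ?thesis using \<delta>(2) by auto
      qed
      with \<delta>(1) show ?thesis by (auto simp: H)
    qed (auto simp: H intro: exI[of _ 1])
    moreover have "\<exists>\<delta>>0. box x \<delta> \<inter> ?B = {}"
    proof (cases "length (\<beta> (n div s)) = s")
      case True
      with xB obtain j where j: "j < s" "x j \<noteq> \<beta> (n div s) ! j"
        by (metis length_map length_upt minus_nat.diff_0 nth_equalityI nth_map_upt add_0)
      have "box x (\<bar>x j - \<beta> (n div s) ! j\<bar> / 2) \<inter> ?B = {}"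
      proof (intro equals0I, elim IntE CollectE)
        fix y assume "y \<in> box x (\<bar>x j - \<beta> (n div s) ! j\<bar> / 2)" "map y [0..<s] = \<beta> (n div s)"
        then have "\<bar>y j - x j\<bar> \<le> \<bar>x j - y j\<bar> / 2"
          using j(1) by (auto simp: box_def dest!: sym[of _ "\<beta> _"])
        moreover have "y j = \<beta> (n div s) ! j"
          using \<open>map y [0..<s] = \<beta> (n div s)\<close> j(1) by (metis add_0 minus_nat.diff_0 nth_map_upt)
        ultimately show False using j(2) by (simp add: abs_minus_commute)
      qed
      with j(2) show ?thesis by (intro exI[of _ "\<bar>x j - \<beta> (n div s) ! j\<bar> / 2"]) auto
    next
      case False
      then have "?B = {}" by (auto dest: arg_cong[of _ _ length])
      then show ?thesis by (intro exI[of _ 1]) simp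
    qed
    ultimately obtain \<delta> \<epsilon> where "0 < \<delta>" "box x \<delta> \<inter> ?H = {}" "0 < \<epsilon>" "box x \<epsilon> \<inter> ?B = {}"
      by blast
    then have "0 < min \<delta> \<epsilon>" "box x (min \<delta> \<epsilon>) \<inter> (?H \<union> ?B) = {}"
      using box_mono[of "min \<delta> \<epsilon>" \<delta> x] box_mono[of "min \<delta> \<epsilon>" \<epsilon> x] by (simp, auto simp: subset_iff)
    then show "\<exists>\<delta>>0. box x \<delta> \<inter> (hyperplane (fst (h (n div s))) (snd (h (n div s))) (n mod s) \<union> ?B) = {}"
      unfolding hc k_def fst_conv snd_conv by blast
  }
  have slice: "countable {t. P (x(k := t))}"
    if "\<And>t u. \<lbrakk>P (x(k := t)); P (x(k := u))\<rbrakk> \<Longrightarrow> t = u" for P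
  proof -
    have "{t. P (x(k := t))} \<subseteq> {u}" if "P (x(k := u))" for u
      using \<open>\<And>t u. \<lbrakk>P (x(k := t)); P (x(k := u))\<rbrakk> \<Longrightarrow> t = u\<close> that by blast
    then have "finite {t. P (x(k := t))}"
      by (cases "\<exists>u. P (x(k := u))") (auto intro: finite_subset)
    then show ?thesis by (rule countable_finite)
  qed
  have "countable {t. x(k := t) \<in> ?H}"
  proof (rule slice)
    have L: "L (x(k := v)) = of_int c0 + (\<Sum>j\<in>{..<s} - {k}. of_int (c ! j) * x j) + of_int (c ! k) * v" for v
      unfolding L_def using k by (subst sum.remove[of _ k]) (auto intro!: sum.cong)
    fix t u assume "x(k := t) \<in> ?H" "x(k := u) \<in> ?H"
    then have "c ! k \<noteq> 0" "L (x(k := t)) = L (x(k := u))" by (simp_all add: H)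
    then show "t = u" by (simp add: L)
  qed
  moreover have "countable {t. x(k := t) \<in> ?B}"
  proof (rule slice)
    fix t u assume "x(k := t) \<in> ?B" "x(k := u) \<in> ?B"
    then have "map (x(k := t)) [0..<s] ! k = map (x(k := u)) [0..<s] ! k" by simp
    with k show "t = u" by simp
  qed
  ultimately have "countable ({t. x(k := t) \<in> ?H} \<union> {t. x(k := t) \<in> ?B})" by (rule countable_Un)
  then show "countable {t. x(n mod s := t) \<in>
      hyperplane (fst (h (n div s))) (snd (h (n div s))) (n mod s) \<union> ?B}"
    by (simp add: hc k_def Collect_disj_eq)
qed

text \<open>Each integer relation is some \<open>h m\<close>, and avoiding it for every direction
  \<open>k\<close> forces all its coefficients \<open>c k\<close> to vanish, hence also
  \<open>c0\<close>.\<close>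

lemma ex_independent_degenerate_avoiding:
  fixes \<beta> :: "nat \<Rightarrow> real list"
  assumes s2: "2 \<le> s"
  obtains \<alpha> where "length \<alpha> = s" "Z_lin_indep \<alpha>" "\<And>m. \<alpha> \<noteq> \<beta> m"
    "\<And>\<nu>. 1 \<le> \<nu> \<Longrightarrow> vec_space.rank (s + 1) (M_mat \<alpha> \<nu>) \<le> 3"
proof -
  define h :: "nat \<Rightarrow> int \<times> int list" where "h = from_nat"
  obtain x where avoid: "\<And>n. x \<notin> hyperplane (fst (h (n div s))) (snd (h (n div s))) (n mod s)
      \<union> {x. map x [0..<s] = \<beta> (n div s)}"
    and rank: "\<And>\<nu>. 1 \<le> \<nu> \<Longrightarrow> vec_space.rank (s + 1) (M_mat (map x [0..<s]) \<nu>) \<le> 3"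
    using ex_degenerate_avoiding[OF avoidable_hyperplanes_and_points s2] by blast
  have avoid': "x \<notin> hyperplane (fst (h m)) (snd (h m)) k \<union> {x. map x [0..<s] = \<beta> m}" if "k < s" for m k
    using avoid[of "m * s + k"] that by simp
  have "Z_lin_indep (map x [0..<s])"
    unfolding Z_lin_indep_def
  proof (intro allI impI)
    fix c0 :: int and c :: "nat \<Rightarrow> int"
    assume "of_int c0 + (\<Sum>j<length (map x [0..<s]). of_int (c j) * map x [0..<s] ! j) = 0"
    then have eq: "of_int c0 + (\<Sum>j<s. of_int (c j) * x j) = 0" by simp
    have c: "c k = 0" if "k < s" for k
    proof -
      have "x \<notin> hyperplane c0 (map c [0..<s]) k"
        using avoid'[OF that, of "to_nat (c0, map c [0..<s])"] by (simp add: h_def)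
      with eq that show ?thesis by (simp add: hyperplane_def)
    qed
    with eq show "c0 = 0 \<and> (\<forall>j<length (map x [0..<s]). c j = 0)" by simp
  qed
  moreover have "map x [0..<s] \<noteq> \<beta> m" for m using avoid'[OF s_pos, of m] by simp
  ultimately show ?thesis using that[of "map x [0..<s]"] rank by simp
qed

end

theorem theorem2p1:
  fixes s :: nat
  assumes "s \<ge> 3"
  shows "\<exists>A :: real list set. uncountable A \<and>
           (\<forall>\<alpha>\<in>A. length \<alpha> = s \<and> Z_lin_indep \<alpha> \<and>
              (\<forall>\<nu>\<ge>1. vec_space.rank (s + 1) (M_mat \<alpha> \<nu>) \<le> 3 \<and>
                       det (M_mat \<alpha> \<nu>) = 0))"
proof (intro exI conjI)
  define A where "A = {\<alpha>. length \<alpha> = s \<and> Z_lin_indep \<alpha> \<and>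
    (\<forall>\<nu>\<ge>1. vec_space.rank (s + 1) (M_mat \<alpha> \<nu>) \<le> 3)}"
  have s: "0 < s" "2 \<le> s" using assms by auto
  show "uncountable A"
  proof
    \<comment> \<open>Diagonal argument: an enumeration of \<open>A\<close> is used as the sequence
      of points to avoid.\<close>
    assume "countable A"
    obtain \<alpha> where "length \<alpha> = s" "Z_lin_indep \<alpha>" "\<And>m. \<alpha> \<noteq> from_nat_into A m"
      "\<And>\<nu>. 1 \<le> \<nu> \<Longrightarrow> vec_space.rank (s + 1) (M_mat \<alpha> \<nu>) \<le> 3"
      using ex_independent_degenerate_avoiding[OF s, of "from_nat_into A"] by metis
    moreover from this have "\<alpha> \<in> A" unfolding A_def by simp
    ultimately show False using \<open>countable A\<close> by (metis from_nat_into_surj)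
  qed
  \<comment> \<open>Here \<open>s \<ge> 3\<close> enters: the matrix has size
    \<open>s + 1 \<ge> 4\<close>, above its rank.\<close>
  have "det (M_mat \<alpha> \<nu>) = 0"
    if "length \<alpha> = s" "vec_space.rank (s + 1) (M_mat \<alpha> \<nu>) \<le> 3" for \<alpha> \<nu>
    using vec_space.low_rank_det_zero[of "M_mat \<alpha> \<nu>" "s + 1"] that assms by (auto simp: M_mat_def)
  then show "\<forall>\<alpha>\<in>A. length \<alpha> = s \<and> Z_lin_indep \<alpha> \<and>
      (\<forall>\<nu>\<ge>1. vec_space.rank (s + 1) (M_mat \<alpha> \<nu>) \<le> 3 \<and> det (M_mat \<alpha> \<nu>) = 0)"
    by (simp add: A_def)
qed

end
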